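(* Assume that either of the following holds: (1) the adversary is weakly communicating, and $Q$ and $\mathcal{P}_s$, for all $s\in S$, are compact; or (2) the adversary is communicating and $\mathcal{P}_s$ is compact for all $s\in S$. Then the constant-gain average-reward inf-sup equation $$u'(s)=\inf_{p_s\in\mathcal{P}_s}\sup_{\phi\in Q}\sum_{a\in A}\sum_{s'\in S}\phi(a)p_s(s'|a)\big[r(s,a)-\alpha'+u'(s')\big]\qquad\forall s\in S$$ has a solution $(u',\alpha')$ with $u':S\to\mathbb{R}$ and $\alpha'\in[0,1]$.
   Context: $S$ (states) and $A$ (actions) are finite nonempty sets; $\mathrm{Prob}(E)$ is the set of probability distributions on a finite set $E$; $r:S\times A\to[0,1]$ is a reward function. $Q\subseteq\mathrm{Prob}(A)$ is nonempty (controller's admissible randomized actions). For each $s\in S$, $\mathcal{P}_s$ is a nonempty set of maps $p_s:A\to\mathrm{Prob}(S)$, written $p_s(s'|a)$; $\mathcal{P}=\prod_{s\in S}\mathcal{P}_s$, and $p\in\mathcal{P}$ (a stationary adversary policy) is written $p(s'|s,a)=p_s(s'|a)$. Compactness is with respect to the Euclidean topology on $\mathbb{R}^{|A|}$, $\mathbb{R}^{|A|\times|S|}$. A stationary controller policy is a map $\Delta:S\to Q$, written $\Delta(a|s)$. For $p\in\mathcal{P}$ and $\Delta:S\to\mathrm{Prob}(A)$, $p_\Delta(s'|s)=\sum_{a\in A}p(s'|s,a)\Delta(a|s)$, and $p_\Delta^n(s'|s)$ is the $(s,s')$ entry of the $n$-th power of the matrix $p_\Delta$. A stationary adversary policy $p\in\mathcal{P}$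 is weakly communicating if there is a set $C_p\subseteq S$ (its communicating class) such that for any $s,s'\in C_p$ there exist $\Delta:S\to Q$ and $N\ge1$ with $p_\Delta^N(s'|s)>0$, and every $s\in S\setminus C_p$ is transient for the Markov chain $p_\Delta$ for every $\Delta:S\to Q$. $p$ is communicating if this holds with $C_p=S$. The adversary is weakly communicating (resp. communicating) if every $p\in\mathcal{P}$ is weakly communicating (resp. communicating); the classes $C_p$ may depend on $p$. *)

theory Defs
  imports "HOL-Analysis.Analysis"
begin

(* Finite nonempty sets of states and actions are rendered as types 's and 'a of class finite.
   Distributions on 'e are vectors in real^'e, and a map from actions to distributions on states
   is an element of real^'s^'a (entry k $ a $ s'), so that "compact" refers to the Euclidean
   topology. *)

definition Prob :: "(real ^ 'e::finite) set" where
  "Prob = {x. (\<forall>i. 0 \<le> x $ i) \<and> (\<Sum>i\<in>UNIV. x $ i) = 1}"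

definition kernels :: "(real ^ 's::finite ^ 'a::finite) set" where
  "kernels = {k. \<forall>a. k $ a \<in> Prob}"

definition induced_chain ::
  "('s::finite \<Rightarrow> real ^ 's ^ 'a::finite) \<Rightarrow> ('s \<Rightarrow> real ^ 'a) \<Rightarrow> real ^ 's ^ 's" where
  "induced_chain p \<Delta> = (\<chi> s s'. \<Sum>a\<in>UNIV. p s $ a $ s' * \<Delta> s $ a)"

(* The class operations on vectors are componentwise, hence no use of (^) here. *)
definition mat_power :: "real ^ 's::finite ^ 's \<Rightarrow> nat \<Rightarrow> real ^ 's ^ 's" where
  "mat_power M n = (((**) M) ^^ n) (mat 1)"

(* first_passage M t n s is the probability that the chain with transition matrix M started
   in s visits t at time n + 1 and at none of the times 1, ..., n. *)
primrec first_passage :: "real ^ 's::finite ^ 's \<Rightarrow> 's \<Rightarrow> nat \<Rightarrow> 's \<Rightarrow> real" where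
  "first_passage M t 0 s = M $ s $ t"
| "first_passage M t (Suc n) s = (\<Sum>y\<in>UNIV - {t}. M $ s $ y * first_passage M t n y)"

(* The probability of ever returning to s is less than one.  For a stochastic matrix the series
   converges, since its partial sums are probabilities. *)
definition transient :: "real ^ 's::finite ^ 's \<Rightarrow> 's \<Rightarrow> bool" where
  "transient M s \<longleftrightarrow> (\<Sum>n. first_passage M s n s) < 1"

definition communicating_class ::
  "(real ^ 'a::finite) set \<Rightarrow> ('s::finite \<Rightarrow> real ^ 's ^ 'a) \<Rightarrow> 's set \<Rightarrow> bool" where
  "communicating_class Q p C \<longleftrightarrow>
     (\<forall>s\<in>C. \<forall>s'\<in>C. \<exists>\<Delta> \<in> UNIV \<rightarrow> Q. \<exists>N\<ge>1. mat_power (induced_chain p \<Delta>) N $ s $ s' > 0) \<and>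
     (\<forall>s\<in>- C. \<forall>\<Delta> \<in> UNIV \<rightarrow> Q. transient (induced_chain p \<Delta>) s)"

definition weakly_communicating ::
  "(real ^ 'a::finite) set \<Rightarrow> ('s::finite \<Rightarrow> real ^ 's ^ 'a) \<Rightarrow> bool" where
  "weakly_communicating Q p \<longleftrightarrow> (\<exists>C. communicating_class Q p C)"

definition communicating ::
  "(real ^ 'a::finite) set \<Rightarrow> ('s::finite \<Rightarrow> real ^ 's ^ 'a) \<Rightarrow> bool" where
  "communicating Q p \<longleftrightarrow> communicating_class Q p UNIV"

(* Pi UNIV P is the set of stationary adversary policies, the product of the sets P s. *)
definition weakly_communicating_adversary ::
  "(real ^ 'a::finite) set \<Rightarrow> ('s::finite \<Rightarrow> (real ^ 's ^ 'a) set) \<Rightarrow> bool" where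
  "weakly_communicating_adversary Q P \<longleftrightarrow> (\<forall>p \<in> Pi UNIV P. weakly_communicating Q p)"

definition communicating_adversary ::
  "(real ^ 'a::finite) set \<Rightarrow> ('s::finite \<Rightarrow> (real ^ 's ^ 'a) set) \<Rightarrow> bool" where
  "communicating_adversary Q P \<longleftrightarrow> (\<forall>p \<in> Pi UNIV P. communicating Q p)"

end

theory Submission
  imports Defs
begin

text \<open>
  For each discount factor \<open>\<gamma> < 1\<close> Brouwer's theorem gives a solution of the
  discounted game.  Subtracting its value at one state turns it into a vector \<open>h\<close> that
  vanishes somewhere and satisfies the average-reward equation up to the factor \<open>\<gamma>\<close>, with a
  constant gain \<open>\<alpha>\<close> in \<open>[0, 1]\<close>.  As \<open>\<gamma>\<close> tends to 1 the vectors \<open>h\<close> could be unbounded, and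
  the communication hypothesis has to rule that out.

  Instead of estimating \<open>h\<close>, the proof passes to the limit projectively.  With
  \<open>t = 1 / (1 + norm h)\<close> and \<open>w = t h\<close> the triples \<open>(w, t, \<alpha>)\<close> stay in a compact set and
  \<open>t + norm w = 1\<close>.  The game operator is continuous and positively homogeneous jointly in the
  reward and the vector, so a limit point satisfies the average-reward equation with reward
  multiplied by \<open>t\<close>.  If \<open>t > 0\<close>, then \<open>w / t\<close> is the required solution.  If \<open>t = 0\<close>, then \<open>w\<close>
  has norm 1, vanishes at some state and solves the game equation with zero reward.

  The last case is impossible because every solution \<open>w\<close> of the equation with zero reward is
  constant (\<open>harmonic_imp_constant\<close>).  Fix adversary kernels that attain the infima; they
  exist by compactness.  Then \<open>w\<close> is superharmonic for every controller policy, so the states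
  where \<open>w\<close> is minimal cannot be left under any policy.  A set that a finite chain cannot leave
  contains a nontransient state (\<open>absorbing_has_nontransient\<close>), so this set meets the
  communicating class and hence contains it.  If the class is the whole state space, \<open>w\<close> is
  constant.  Otherwise the set of actions is compact, some policy attains the suprema, \<open>w\<close> is
  harmonic for it, and the states where \<open>w\<close> is maximal cannot be left under that policy.  They
  meet the communicating class as well, so the maximum of \<open>w\<close> equals its minimum.
\<close>

section \<open>Absorbing sets of a finite Markov chain\<close>

definition stochastic :: "real ^ 's::finite ^ 's \<Rightarrow> bool" where
  "stochastic M \<longleftrightarrow> (\<forall>s. M $ s \<in> Prob)"

definition absorbing :: "real ^ 's::finite ^ 's \<Rightarrow> 's set \<Rightarrow> bool" where
  "absorbing M D \<longleftrightarrow> (\<forall>s\<in>D. \<forall>y. 0 < M $ s $ y \<longrightarrow> y \<in> D)"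

lemma ProbD:
  assumes "x \<in> Prob"
  shows "0 \<le> x $ i" and "(\<Sum>i\<in>UNIV. x $ i) = 1"
  using assms by (auto simp: Prob_def)

lemma stochasticD:
  assumes "stochastic M"
  shows "0 \<le> M $ s $ y" and "(\<Sum>y\<in>UNIV. M $ s $ y) = 1"
  using assms by (auto simp: stochastic_def ProbD)

text \<open>
  The equality case of averaging: a mean that does not exceed the minimum charges only points
  where the minimum is attained.  All maximum principles below are instances, those for maxima
  through a change of sign.
\<close>

lemma Prob_mean_at_minimum:
  fixes x w :: "real ^ 'e::finite"
  assumes x: "x \<in> Prob" and lb: "\<And>y. m \<le> w $ y"
    and mean: "(\<Sum>y\<in>UNIV. x $ y * w $ y) \<le> m" and pos: "0 < x $ y"
  shows "w $ y = m"
proof -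
  have nonneg: "0 \<le> x $ z * (w $ z - m)" for z
    using ProbD(1)[OF x] lb by simp
  have "(\<Sum>z\<in>UNIV. x $ z * (w $ z - m)) = (\<Sum>z\<in>UNIV. x $ z * w $ z) - (\<Sum>z\<in>UNIV. x $ z) * m"
    by (simp add: right_diff_distrib sum_subtractf sum_distrib_right)
  also have "\<dots> \<le> 0"
    using mean ProbD(2)[OF x] by simp
  finally have "(\<Sum>z\<in>UNIV. x $ z * (w $ z - m)) = 0"
    using nonneg by (meson antisym sum_nonneg)
  then have "x $ y * (w $ y - m) = 0"
    using nonneg by (simp add: sum_nonneg_eq_0_iff)
  then show ?thesis using pos by simp
qed

lemma first_passage_nonneg:
  assumes "stochastic M"
  shows "0 \<le> first_passage M t n s"
proof (induction n arbitrary: s)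
  case 0
  show ?case using stochasticD(1)[OF assms] by simp
next
  case (Suc n)
  show ?case
    unfolding first_passage.simps
    by (intro sum_nonneg mult_nonneg_nonneg stochasticD(1)[OF assms] Suc.IH)
qed

lemma sum_split_target:
  fixes f :: "'s::finite \<Rightarrow> real"
  shows "(\<Sum>y\<in>UNIV. f y) = f t + (\<Sum>y\<in>UNIV - {t}. f y)"
  by (simp add: sum.remove)

lemma first_passage_partial_sums:
  assumes M: "stochastic M"
  shows "(\<Sum>n<N. first_passage M t n s) \<le> 1"
proof (induction N arbitrary: s)
  case 0
  show ?case by simp
next
  case (Suc N)
  have "(\<Sum>n<Suc N. first_passage M t n s)
      = M $ s $ t + (\<Sum>y\<in>UNIV - {t}. M $ s $ y * (\<Sum>n<N. first_passage M t n y))"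
    by (simp only: sum.lessThan_Suc_shift first_passage.simps sum.swap[of _ "UNIV - {t}"]
        sum_distrib_left)
  also have "\<dots> \<le> M $ s $ t + (\<Sum>y\<in>UNIV - {t}. M $ s $ y)"
    using Suc.IH stochasticD(1)[OF M] by (auto intro!: sum_mono mult_left_le)
  also have "\<dots> = 1"
    using stochasticD(2)[OF M, of s] sum_split_target[of "\<lambda>y. M $ s $ y" t] by simp
  finally show ?case .
qed

lemma first_passage_summable:
  assumes "stochastic M"
  shows "summable (\<lambda>n. first_passage M t n s)"
  by (rule summableI_nonneg_bounded[where x = 1])
    (auto simp: first_passage_nonneg[OF assms] first_passage_partial_sums[OF assms])

definition hitting :: "real ^ 's::finite ^ 's \<Rightarrow> 's \<Rightarrow> 's \<Rightarrow> real" where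
  "hitting M t s = (\<Sum>n. first_passage M t n s)"

lemma hitting_le_1:
  assumes "stochastic M"
  shows "hitting M t s \<le> 1"
  unfolding hitting_def
  using first_passage_summable[OF assms] first_passage_partial_sums[OF assms]
  by (rule suminf_le_const)

lemma hitting_first_step:
  assumes M: "stochastic M"
  shows "hitting M t s = M $ s $ t + (\<Sum>y\<in>UNIV - {t}. M $ s $ y * hitting M t y)"
proof -
  have "hitting M t s = first_passage M t 0 s + (\<Sum>n. first_passage M t (Suc n) s)"
    unfolding hitting_def using suminf_split_head[OF first_passage_summable[OF M, of t s]] by simp
  also have "(\<Sum>n. first_passage M t (Suc n) s)
      = (\<Sum>y\<in>UNIV - {t}. \<Sum>n. M $ s $ y * first_passage M t n y)"
    using first_passage_summable[OF M] by (simp add: suminf_sum summable_mult)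
  also have "\<dots> = (\<Sum>y\<in>UNIV - {t}. M $ s $ y * hitting M t y)"
    unfolding hitting_def using first_passage_summable[OF M] by (simp add: suminf_mult)
  finally show ?thesis by simp
qed

text \<open>
  In a minimal absorbing set \<open>D\<close> any state \<open>t\<close> is nontransient.  By the first-step equation the
  probability \<open>g\<close> of never hitting \<open>t\<close> is harmonic away from \<open>t\<close>, and a step into \<open>t\<close> contributes
  zero to the average.  Where \<open>g\<close> attains a positive maximum over \<open>D\<close>, the chain therefore cannot
  step into \<open>t\<close> and must stay among the maximal states.  These states without \<open>t\<close> form a strictly
  smaller nonempty absorbing set, which contradicts minimality.  This avoids
  the renewal theory of the powers of \<open>M\<close>.
\<close>

lemma absorbing_has_nontransient:
  fixes M :: "real ^ 's::finite ^ 's"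
  assumes M: "stochastic M" and D0: "absorbing M D0" "D0 \<noteq> {}"
  shows "\<exists>t\<in>D0. \<not> transient M t"
proof -
  define closed where "closed D \<longleftrightarrow> absorbing M D \<and> D \<noteq> {} \<and> D \<subseteq> D0" for D
  have "closed D0" using D0 by (simp add: closed_def)
  then obtain D where D': "closed D" and least: "\<And>D'. closed D' \<Longrightarrow> card D \<le> card D'"
    using ex_has_least_nat[of closed D0 card] by blast
  then have D: "absorbing M D" "D \<noteq> {}" "D \<subseteq> D0" by (auto simp: closed_def)
  have min: "D' = {}" if "D' \<subset> D" "absorbing M D'" for D'
  proof (rule ccontr)
    assume "D' \<noteq> {}"
    then have "closed D'" using that D(3) by (auto simp: closed_def)
    then have "card D \<le> card D'" by (rule least)
    moreover have "card D' < card D" using that(1) by (simp add: psubset_card_mono)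
    ultimately show False by simp
  qed
  obtain t where t: "t \<in> D" using D by blast
  define g where "g s = 1 - hitting M t s" for s
  have g_nonneg: "0 \<le> g s" for s
    unfolding g_def using hitting_le_1[OF M] by simp
  have g_step: "g s = (\<Sum>y\<in>UNIV - {t}. M $ s $ y * g y)" for s
    using stochasticD(2)[OF M, of s] sum_split_target[of "\<lambda>y. M $ s $ y" t]
    unfolding g_def hitting_first_step[OF M, of t s]
    by (simp add: right_diff_distrib sum_subtractf)
  obtain s0 where s0: "s0 \<in> D" "\<And>y. y \<in> D \<Longrightarrow> g y \<le> g s0"
  proof -
    have "Max (g ` D) \<in> g ` D" using D by (intro Max_in) auto
    then obtain s0 where "s0 \<in> D" "Max (g ` D) = g s0" by blast
    then show ?thesis using that[of s0] Max_ge[of "g ` D"] by simp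
  qed
  have "g s0 = 0"
  proof (rule ccontr)
    assume "g s0 \<noteq> 0"
    then have pos: "0 < g s0" using g_nonneg[of s0] by linarith
    define D' where "D' = {s \<in> D. g s = g s0}"
    have step: "y \<noteq> t \<and> y \<in> D'" if s: "s \<in> D'" and y: "0 < M $ s $ y" for s y
    proof -
      \<comment> \<open>The averaged function is \<open>-g\<close>, with \<open>t\<close> set to 0 because the first-step equation omits it.
          Outside \<open>D\<close>, which is never reached, any value above the lower bound will do.\<close>
      define w :: "real ^ 's" where
        "w = (\<chi> z. if z = t then 0 else if z \<in> D then - g z else - g s0)"
      have sD: "s \<in> D" using s by (simp add: D'_def)
      have out: "M $ s $ z = 0" if "z \<notin> D" for z
        using D(1) sD that stochasticD(1)[OF M, of s z] by (force simp: absorbing_def)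
      have "(\<Sum>z\<in>UNIV. M $ s $ z * w $ z) = (\<Sum>z\<in>UNIV - {t}. M $ s $ z * w $ z)"
        by (simp add: sum_split_target[of _ t] w_def)
      also have "\<dots> = (\<Sum>z\<in>UNIV - {t}. - (M $ s $ z * g z))"
        using out by (intro sum.cong) (auto simp: w_def)
      also have "\<dots> = - g s0"
        using g_step[of s] s by (simp add: D'_def sum_negf)
      finally have "w $ y = - g s0"
        using M s0(2) pos y
        by (intro Prob_mean_at_minimum[of "M $ s"]) (auto simp: w_def stochastic_def)
      moreover have "y \<in> D" using D(1) sD y by (auto simp: absorbing_def)
      ultimately show ?thesis using pos by (auto simp: w_def D'_def split: if_splits)
    qed
    have "absorbing M (D' - {t})" using step by (auto simp: absorbing_def)
    moreover have "D' - {t} \<subset> D" using t by (auto simp: D'_def)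
    ultimately have "D' - {t} = {}" using min by blast
    moreover have "\<exists>y. 0 < M $ s0 $ y"
    proof (rule ccontr)
      assume "\<nexists>y. 0 < M $ s0 $ y"
      then have "(\<Sum>y\<in>UNIV. M $ s0 $ y) \<le> 0" by (intro sum_nonpos) (auto simp: not_less)
      then show False using stochasticD(2)[OF M] by simp
    qed
    ultimately show False using step[of s0] s0(1) by (auto simp: D'_def)
  qed
  then have "g t = 0" using s0(2)[OF t] g_nonneg[of t] by linarith
  then have "\<not> transient M t" by (simp add: g_def transient_def hitting_def)
  then show ?thesis using t D(3) by blast
qed

lemma absorbing_mat_power:
  fixes M :: "real ^ 's::finite ^ 's"
  assumes M: "stochastic M" and D: "absorbing M D"
  shows "s \<in> D \<Longrightarrow> 0 < mat_power M N $ s $ y \<Longrightarrow> y \<in> D"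
proof (induction N arbitrary: s)
  case 0
  then show ?case by (simp add: mat_power_def mat_def split: if_splits)
next
  case (Suc N)
  have nonneg: "0 \<le> mat_power M n $ z $ y" for n z
    by (induction n arbitrary: z)
      (auto simp: mat_power_def mat_def matrix_matrix_mult_def stochasticD(1)[OF M]
        intro!: sum_nonneg)
  have "0 < (\<Sum>z\<in>UNIV. M $ s $ z * mat_power M N $ z $ y)"
    using Suc.prems by (simp add: mat_power_def matrix_matrix_mult_def)
  then obtain z where z: "0 < M $ s $ z * mat_power M N $ z $ y"
    by (metis (no_types, lifting) not_less sum_nonpos)
  then have "0 < M $ s $ z" "0 < mat_power M N $ z $ y"
    using nonneg[of N z] stochasticD(1)[OF M, of s z] by (auto simp: zero_less_mult_iff)
  then show ?case using Suc.IH Suc.prems(1) D by (auto simp: absorbing_def)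
qed

section \<open>The one-stage game\<close>

definition payoff ::
  "('a::finite \<Rightarrow> real) \<Rightarrow> real ^ 's::finite \<Rightarrow> real ^ 'a \<Rightarrow> real ^ 's ^ 'a \<Rightarrow> real" where
  "payoff c u \<phi> k = (\<Sum>a\<in>UNIV. \<Sum>s'\<in>UNIV. \<phi> $ a * k $ a $ s' * (c a + u $ s'))"

lemma kernelsD: "k \<in> kernels \<Longrightarrow> k $ a \<in> Prob"
  by (simp add: kernels_def)

lemma weights_sum:
  assumes "\<phi> \<in> Prob" and "k \<in> kernels"
  shows "(\<Sum>a\<in>UNIV. \<Sum>s'\<in>UNIV. \<phi> $ a * k $ a $ s') = 1"
  using assms by (simp add: sum_distrib_left[symmetric] ProbD(2) kernelsD)

lemma payoff_affine_le:
  assumes \<phi>: "\<phi> \<in> Prob" and k: "k \<in> kernels"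
    and le: "\<And>a s'. c a + u $ s' \<le> x * (c' a + u' $ s') + d"
  shows "payoff c u \<phi> k \<le> x * payoff c' u' \<phi> k + d"
proof -
  have "payoff c u \<phi> k \<le> (\<Sum>a\<in>UNIV. \<Sum>s'\<in>UNIV. \<phi> $ a * k $ a $ s' * (x * (c' a + u' $ s') + d))"
    unfolding payoff_def
    using le ProbD(1)[OF \<phi>] ProbD(1)[OF kernelsD[OF k]] by (intro sum_mono mult_left_mono) auto
  also have "\<dots> = x * payoff c' u' \<phi> k + (\<Sum>a\<in>UNIV. \<Sum>s'\<in>UNIV. \<phi> $ a * k $ a $ s') * d"
    unfolding payoff_def sum_distrib_left sum_distrib_right sum.distrib[symmetric]
    by (intro sum.cong) (auto simp: algebra_simps)
  finally show ?thesis using weights_sum[OF \<phi> k] by simp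
qed

lemma payoff_abs_le:
  assumes \<phi>: "\<phi> \<in> Prob" and k: "k \<in> kernels"
    and le: "\<And>a s'. \<bar>c a + u $ s'\<bar> \<le> B"
  shows "\<bar>payoff c u \<phi> k\<bar> \<le> B"
proof -
  have bounds: "- B \<le> c a + u $ s'" "c a + u $ s' \<le> B" for a s'
    using le[of a s'] by linarith+
  have zero: "payoff (\<lambda>_. 0) 0 \<phi> k = 0" by (simp add: payoff_def)
  have "payoff c u \<phi> k \<le> 1 * payoff (\<lambda>_. 0) 0 \<phi> k + B"
    by (rule payoff_affine_le[OF \<phi> k]) (use bounds in simp)
  moreover have "payoff (\<lambda>_. 0) 0 \<phi> k \<le> 1 * payoff c u \<phi> k + B"
  proof (rule payoff_affine_le[OF \<phi> k])
    fix a s'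
    show "0 + (0 :: real ^ _) $ s' \<le> 1 * (c a + u $ s') + B" using bounds(1)[of a s'] by simp
  qed
  ultimately show ?thesis using zero by (simp add: abs_le_iff)
qed

lemma stage_reward_bounded:
  fixes c :: "'a::finite \<Rightarrow> real" and u :: "real ^ 's::finite"
  obtains B where "\<And>a s'. \<bar>c a + u $ s'\<bar> \<le> B"
proof
  fix a s'
  have "\<bar>c a\<bar> \<le> (\<Sum>a\<in>UNIV. \<bar>c a\<bar>)" "\<bar>u $ s'\<bar> \<le> norm u"
    by (auto intro: member_le_sum component_le_norm_cart)
  then show "\<bar>c a + u $ s'\<bar> \<le> (\<Sum>a\<in>UNIV. \<bar>c a\<bar>) + norm u" by linarith
qed

locale stage_game =
  fixes P :: "(real ^ 's::finite ^ 'a::finite) set" and Q :: "(real ^ 'a) set"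
  assumes Q_nonempty: "Q \<noteq> {}" and Q_Prob: "Q \<subseteq> Prob"
    and P_nonempty: "P \<noteq> {}" and P_kernels: "P \<subseteq> kernels"
begin

text \<open>The payoff that the controller can secure once the kernel \<open>k\<close> is known.\<close>

definition best_reply :: "('a \<Rightarrow> real) \<Rightarrow> real ^ 's \<Rightarrow> real ^ 's ^ 'a \<Rightarrow> real" where
  "best_reply c u k = (SUP \<phi>\<in>Q. payoff c u \<phi> k)"

definition stage_value :: "('a \<Rightarrow> real) \<Rightarrow> real ^ 's \<Rightarrow> real" where
  "stage_value c u = (INF k\<in>P. best_reply c u k)"

lemma payoff_le_best_reply:
  assumes "\<phi> \<in> Q" and k: "k \<in> kernels"
  shows "payoff c u \<phi> k \<le> best_reply c u k"
proof -
  obtain B where B: "\<And>a s'. \<bar>c a + u $ s'\<bar> \<le> B" 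
    using stage_reward_bounded[of c u] by blast
  have "bdd_above ((\<lambda>\<phi>. payoff c u \<phi> k) ` Q)"
    using payoff_abs_le[OF _ k B] Q_Prob by (intro bdd_aboveI[of _ B]) (force simp: abs_le_iff)
  then show ?thesis unfolding best_reply_def using assms(1) by (rule cSUP_upper2) simp
qed

lemma best_reply_le:
  assumes "\<And>\<phi>. \<phi> \<in> Q \<Longrightarrow> payoff c u \<phi> k \<le> b"
  shows "best_reply c u k \<le> b"
  unfolding best_reply_def using Q_nonempty assms by (rule cSUP_least)

lemma stage_value_le_best_reply:
  assumes "k \<in> P"
  shows "stage_value c u \<le> best_reply c u k"
proof -
  obtain B where B: "\<And>a s'. \<bar>c a + u $ s'\<bar> \<le> B" 
    using stage_reward_bounded[of c u] by blast
  obtain \<phi> where \<phi>: "\<phi> \<in> Q" using Q_nonempty by blast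
  have "bdd_below (best_reply c u ` P)"
  proof (rule bdd_belowI)
    fix x assume "x \<in> best_reply c u ` P"
    then obtain k where k: "k \<in> kernels" "x = best_reply c u k" using P_kernels by blast
    then show "- B \<le> x"
      using payoff_abs_le[of \<phi> k c u B, OF _ k(1) B] payoff_le_best_reply[OF \<phi> k(1), of c u] \<phi> Q_Prob
      by force
  qed
  then show ?thesis unfolding stage_value_def using assms by (rule cINF_lower)
qed

text \<open>
  Monotonicity, translation equivariance, positive homogeneity and the Lipschitz bound of the
  value all follow from this one comparison.
\<close>

lemma stage_value_affine_le:
  assumes x: "0 < x" and le: "\<And>a s'. c a + u $ s' \<le> x * (c' a + u' $ s') + d"
  shows "stage_value c u \<le> x * stage_value c' u' + d"
proof -
  have "(stage_value c u - d) / x \<le> best_reply c' u' k" if k: "k \<in> P" for k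
  proof -
    have kk: "k \<in> kernels" using k P_kernels by blast
    have "best_reply c u k \<le> x * best_reply c' u' k + d"
    proof (rule best_reply_le)
      fix \<phi> assume \<phi>: "\<phi> \<in> Q"
      then have "payoff c u \<phi> k \<le> x * payoff c' u' \<phi> k + d"
        using Q_Prob by (intro payoff_affine_le[OF _ kk le]) auto
      also have "\<dots> \<le> x * best_reply c' u' k + d"
        using x payoff_le_best_reply[OF \<phi> kk] by simp
      finally show "payoff c u \<phi> k \<le> x * best_reply c' u' k + d" .
    qed
    with stage_value_le_best_reply[OF k, of c u] x show ?thesis
      by (simp add: pos_divide_le_eq mult.commute)
  qed
  then have "(stage_value c u - d) / x \<le> stage_value c' u'"
    unfolding stage_value_def[of c' u'] using P_nonempty by (intro cINF_greatest)
  then show ?thesis using x by (simp add: pos_divide_le_eq mult.commute)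
qed

lemma stage_value_affine:
  assumes x: "0 < x" and eq: "\<And>a s'. c a + u $ s' = x * (c' a + u' $ s') + d"
  shows "stage_value c u = x * stage_value c' u' + d"
proof (rule antisym)
  show "stage_value c u \<le> x * stage_value c' u' + d"
    using x eq by (intro stage_value_affine_le) auto
  have "stage_value c' u' \<le> (1 / x) * stage_value c u + (- d / x)"
    using x eq by (intro stage_value_affine_le) (auto simp: field_simps)
  then show "x * stage_value c' u' + d \<le> stage_value c u"
    using x by (simp add: field_simps)
qed

lemma stage_value_0: "stage_value (\<lambda>_. 0) 0 = 0"
proof -
  \<comment> \<open>Homogeneity under doubling leaves 0 as the only possible value.\<close>
  have "stage_value (\<lambda>_. 0) 0 = 2 * stage_value (\<lambda>_. 0) 0 + 0"
    by (rule stage_value_affine) auto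
  then show ?thesis by linarith
qed

lemma stage_value_bounds:
  assumes "\<And>a s'. 0 \<le> c a + u $ s'" and "\<And>a s'. c a + u $ s' \<le> b"
  shows "0 \<le> stage_value c u" and "stage_value c u \<le> b"
proof -
  have "stage_value (\<lambda>_. 0) 0 \<le> 1 * stage_value c u + 0"
    by (rule stage_value_affine_le) (use assms in auto)
  then show "0 \<le> stage_value c u" using stage_value_0 by simp
  have "stage_value c u \<le> 1 * stage_value (\<lambda>_. 0) 0 + b"
    by (rule stage_value_affine_le) (use assms in auto)
  then show "stage_value c u \<le> b" using stage_value_0 by simp
qed

lemma tendsto_stage_value:
  assumes c: "\<And>a. (\<lambda>n. c n a) \<longlonglongrightarrow> c' a" and u: "u \<longlonglongrightarrow> u'"
  shows "(\<lambda>n. stage_value (c n) (u n)) \<longlonglongrightarrow> stage_value c' u'"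
proof -
  define d where "d n = (\<Sum>a\<in>UNIV. \<bar>c n a - c' a\<bar>) + norm (u n - u')" for n
  have pw: "\<bar>(c n a + u n $ s') - (c' a + u' $ s')\<bar> \<le> d n" for n a s'
  proof -
    have "\<bar>c n a - c' a\<bar> \<le> (\<Sum>a\<in>UNIV. \<bar>c n a - c' a\<bar>)"
      by (rule member_le_sum) auto
    moreover have "\<bar>u n $ s' - u' $ s'\<bar> \<le> norm (u n - u')"
      using component_le_norm_cart[of "u n - u'" s'] by simp
    ultimately show ?thesis unfolding d_def by linarith
  qed
  have close: "norm (stage_value (c n) (u n) - stage_value c' u') \<le> d n" for n
  proof -
    have "stage_value (c n) (u n) \<le> 1 * stage_value c' u' + d n"
      using pw[of n] by (intro stage_value_affine_le) (auto simp: abs_le_iff algebra_simps)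
    moreover have "stage_value c' u' \<le> 1 * stage_value (c n) (u n) + d n"
      using pw[of n] by (intro stage_value_affine_le) (auto simp: abs_le_iff algebra_simps)
    ultimately show ?thesis by simp
  qed
  have d_lim: "d \<longlonglongrightarrow> 0"
  proof -
    have "d \<longlonglongrightarrow> (\<Sum>a\<in>UNIV. \<bar>c' a - c' a\<bar>) + norm (u' - u')"
      unfolding d_def by (intro tendsto_intros c u)
    then show ?thesis by simp
  qed
  have "(\<lambda>n. stage_value (c n) (u n) - stage_value c' u') \<longlonglongrightarrow> 0"
    by (rule Lim_null_comparison[OF _ d_lim]) (simp add: close del: real_norm_def)
  then show ?thesis by (rule LIM_zero_cancel)
qed

text \<open>
  The best reply is Lipschitz in the kernel, as a supremum of payoffs that are Lipschitz with a
  constant independent of the action.  Hence it is continuous and attains its infimum over \<open>P\<close>.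
\<close>

lemma optimal_kernel_exists:
  assumes "compact P"
  obtains k where "k \<in> P" and "stage_value c u = best_reply c u k"
proof -
  obtain B where B: "\<And>a s'. \<bar>c a + u $ s'\<bar> \<le> B" 
    using stage_reward_bounded[of c u] by blast
  define L where "L k k' = (\<Sum>a\<in>UNIV. \<Sum>s'\<in>UNIV. \<bar>k $ a $ s' - k' $ a $ s'\<bar> * B)"
    for k k' :: "real ^ 's ^ 'a"
  have L_sym: "L k k' = L k' k" for k k' by (simp add: L_def abs_minus_commute)
  have upper: "best_reply c u k \<le> best_reply c u k' + L k k'" if k': "k' \<in> P" for k k'
  proof (rule best_reply_le)
    fix \<phi> assume \<phi>: "\<phi> \<in> Q"
    have \<phi>1: "\<bar>\<phi> $ a\<bar> \<le> 1" for a
      using \<phi> Q_Prob member_le_sum[of a UNIV "\<lambda>i. \<phi> $ i"] by (auto simp: Prob_def)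
    have "payoff c u \<phi> k - payoff c u \<phi> k'
        = (\<Sum>a\<in>UNIV. \<Sum>s'\<in>UNIV. \<phi> $ a * ((k $ a $ s' - k' $ a $ s') * (c a + u $ s')))"
      unfolding payoff_def sum_subtractf[symmetric]
      by (intro sum.cong) (auto simp: algebra_simps)
    also have "\<dots> \<le> L k k'" unfolding L_def
    proof (intro sum_mono)
      fix a s'
      have "\<phi> $ a * ((k $ a $ s' - k' $ a $ s') * (c a + u $ s'))
          \<le> \<bar>\<phi> $ a\<bar> * (\<bar>k $ a $ s' - k' $ a $ s'\<bar> * \<bar>c a + u $ s'\<bar>)"
        by (metis abs_ge_self abs_mult)
      also have "\<dots> \<le> 1 * (\<bar>k $ a $ s' - k' $ a $ s'\<bar> * B)"
        using \<phi>1 B by (intro mult_mono mult_left_mono) auto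
      finally show "\<phi> $ a * ((k $ a $ s' - k' $ a $ s') * (c a + u $ s'))
          \<le> \<bar>k $ a $ s' - k' $ a $ s'\<bar> * B" by simp
    qed
    finally show "payoff c u \<phi> k \<le> best_reply c u k' + L k k'"
      using payoff_le_best_reply[OF \<phi>, of k' c u] k' P_kernels by force
  qed
  have "continuous_on P (best_reply c u)"
    unfolding continuous_on_def
  proof
    fix k' assume k': "k' \<in> P"
    have "((\<lambda>k. L k k') \<longlongrightarrow> L k' k') (at k' within P)"
      unfolding L_def by (intro tendsto_intros)
    moreover have "L k' k' = 0" by (simp add: L_def)
    moreover have "\<forall>\<^sub>F k in at k' within P. norm (best_reply c u k - best_reply c u k') \<le> L k k'"
      unfolding eventually_at_filter
    proof (intro always_eventually allI impI)
      fix k assume "k \<in> P"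
      then show "norm (best_reply c u k - best_reply c u k') \<le> L k k'"
        using upper[OF k', of k] upper[of k k'] L_sym[of k' k] by simp
    qed
    ultimately show "(best_reply c u \<longlongrightarrow> best_reply c u k') (at k' within P)"
      by (intro LIM_zero_cancel[of _ "best_reply c u k'"]) (auto intro: Lim_null_comparison)
  qed
  then obtain k where k: "k \<in> P" "\<And>k'. k' \<in> P \<Longrightarrow> best_reply c u k \<le> best_reply c u k'"
    using continuous_attains_inf[OF assms P_nonempty] by metis
  have "best_reply c u k \<le> stage_value c u"
    unfolding stage_value_def using P_nonempty k(2) by (rule cINF_greatest)
  then show ?thesis using that[OF k(1)] stage_value_le_best_reply[OF k(1)] by (meson antisym)
qed

lemma optimal_action_exists:
  assumes "compact Q" and k: "k \<in> kernels"
  obtains \<phi> where "\<phi> \<in> Q" and "best_reply c u k = payoff c u \<phi> k"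
proof -
  have "continuous_on Q (\<lambda>\<phi>. payoff c u \<phi> k)"
    unfolding payoff_def by (intro continuous_intros)
  then obtain \<phi> where \<phi>: "\<phi> \<in> Q" "\<And>\<psi>. \<psi> \<in> Q \<Longrightarrow> payoff c u \<psi> k \<le> payoff c u \<phi> k"
    using continuous_attains_sup[OF assms(1) Q_nonempty] by metis
  then show ?thesis
    using that best_reply_le payoff_le_best_reply[OF \<phi>(1) k] by (meson antisym)
qed

end

section \<open>The game equation without rewards\<close>

lemma payoff_induced_chain:
  "payoff (\<lambda>_. 0) w (\<Delta> s) (p s) = (\<Sum>y\<in>UNIV. induced_chain p \<Delta> $ s $ y * w $ y)"
  unfolding payoff_def induced_chain_def
  by (subst sum.swap) (simp add: sum_distrib_left sum_distrib_right mult_ac)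

lemma stochastic_induced_chain:
  assumes "\<And>s. \<Delta> s \<in> Prob" and "\<And>s. p s \<in> kernels"
  shows "stochastic (induced_chain p \<Delta>)"
proof -
  have "(\<Sum>s'\<in>UNIV. \<Sum>a\<in>UNIV. p s $ a $ s' * \<Delta> s $ a) = 1" for s
    by (subst sum.swap) (use weights_sum[OF assms(1) assms(2), of s s] in \<open>simp add: mult.commute\<close>)
  then show ?thesis
    using ProbD(1)[OF assms(1)] ProbD(1)[OF kernelsD[OF assms(2)]]
    by (auto simp: stochastic_def Prob_def induced_chain_def intro!: sum_nonneg)
qed

locale robust_game =
  fixes P :: "'s::finite \<Rightarrow> (real ^ 's ^ 'a::finite) set" and Q :: "(real ^ 'a) set"
  assumes stage: "\<And>s. stage_game (P s) Q"
begin

definition val :: "('s \<Rightarrow> 'a \<Rightarrow> real) \<Rightarrow> real ^ 's \<Rightarrow> real ^ 's" where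
  "val c u = (\<chi> s. stage_game.stage_value (P s) Q (c s) u)"

text \<open>
  This is where the communication hypothesis is used.  The set \<open>E\<close> of minimal states is absorbing
  under every policy and so swallows the communicating class; the set \<open>D\<close> of maximal states
  is absorbing under the optimal policy and so meets that class.
\<close>

lemma harmonic_imp_constant:
  fixes w :: "real ^ 's"
  assumes w: "w = val (\<lambda>_ _. 0) w"
    and comp: "\<And>s. compact (P s)"
    and comm: "(weakly_communicating_adversary Q P \<and> compact Q) \<or> communicating_adversary Q P"
  shows "w $ s = w $ s'"
proof -
  have Q: "Q \<noteq> {}" "Q \<subseteq> Prob" and P: "P s \<subseteq> kernels" for s
    using stage by (auto simp: stage_game_def)
  define m where "m = Min (range (($) w))"
  define top where "top = Max (range (($) w))"
  have m: "m \<le> w $ y" and top: "w $ y \<le> top" for y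
    by (auto simp: m_def top_def)
  define E where "E = {y. w $ y = m}"
  define D where "D = {y. w $ y = top}"
  have "m \<in> range (($) w)" "top \<in> range (($) w)"
    unfolding m_def top_def by (auto intro!: Min_in Max_in simp del: rangeI)
  then have ne: "E \<noteq> {}" "D \<noteq> {}" by (auto simp: E_def D_def)
  have "\<exists>k\<in>P y. w $ y = stage_game.best_reply Q (\<lambda>_. 0) w k" for y
    using stage_game.optimal_kernel_exists[OF stage[of y] comp, of "\<lambda>_. 0" w] arg_cong[OF w, of "\<lambda>v. v $ y"]
    unfolding val_def by (metis vec_lambda_beta)
  then obtain p where p: "\<And>y. p y \<in> P y"
    and wp: "\<And>y. w $ y = stage_game.best_reply Q (\<lambda>_. 0) w (p y)" by metis
  have pk: "p y \<in> kernels" for y using p P by blast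
  have stoch: "stochastic (induced_chain p \<Delta>)" if "\<Delta> \<in> UNIV \<rightarrow> Q" for \<Delta>
    using that Q pk by (intro stochastic_induced_chain) auto
  have E_abs: "absorbing (induced_chain p \<Delta>) E" if \<Delta>: "\<Delta> \<in> UNIV \<rightarrow> Q" for \<Delta>
    unfolding absorbing_def
  proof (intro ballI allI impI)
    fix x y assume x: "x \<in> E" and y: "0 < induced_chain p \<Delta> $ x $ y"
    have "(\<Sum>y\<in>UNIV. induced_chain p \<Delta> $ x $ y * w $ y) \<le> w $ x"
      using stage_game.payoff_le_best_reply[OF stage _ pk, of "\<Delta> x" "\<lambda>_. 0" w x] \<Delta>
      by (auto simp: wp[of x] payoff_induced_chain)
    then have "w $ y = m"
      using x y m stoch[OF \<Delta>]
      by (intro Prob_mean_at_minimum[of "induced_chain p \<Delta> $ x"]) (auto simp: E_def stochastic_def)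
    then show "y \<in> E" by (simp add: E_def)
  qed
  \<comment> \<open>Both alternatives of the hypothesis enter the rest of the proof only through this one.\<close>
  obtain C where C: "communicating_class Q p C" and C_cases: "compact Q \<or> C = UNIV"
    using comm p
    unfolding weakly_communicating_adversary_def communicating_adversary_def
      weakly_communicating_def communicating_def by blast
  have meets: "D' \<inter> C \<noteq> {}"
    if "absorbing (induced_chain p \<Delta>) D'" "D' \<noteq> {}" "\<Delta> \<in> UNIV \<rightarrow> Q" for \<Delta> D'
    using absorbing_has_nontransient[OF stoch[OF that(3)] that(1,2)] C that(3)
    unfolding communicating_class_def by blast
  obtain \<phi> where "\<phi> \<in> Q" using Q by blast
  then obtain x where x: "x \<in> E" "x \<in> C" using meets[OF E_abs ne(1), of "\<lambda>_. \<phi>"] by blast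
  have CE: "C \<subseteq> E"
  proof
    fix y assume "y \<in> C"
    then obtain \<Delta> N where "\<Delta> \<in> UNIV \<rightarrow> Q" "0 < mat_power (induced_chain p \<Delta>) N $ x $ y"
      using C x(2) unfolding communicating_class_def by blast
    then show "y \<in> E" using absorbing_mat_power[OF stoch E_abs] x(1) by blast
  qed
  have "top = m"
  proof (cases "C = UNIV")
    case True
    then show ?thesis using CE ne(2) by (auto simp: E_def D_def)
  next
    case False
    then have "\<exists>\<phi>\<in>Q. w $ y = payoff (\<lambda>_. 0) w \<phi> (p y)" for y
      using C_cases stage_game.optimal_action_exists[OF stage _ pk, of "\<lambda>_. 0" w y] wp by metis
    then obtain \<Delta> where \<Delta>: "\<And>y. \<Delta> y \<in> Q"
      and w\<Delta>: "\<And>y. w $ y = payoff (\<lambda>_. 0) w (\<Delta> y) (p y)" by metis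
    have \<Delta>': "\<Delta> \<in> UNIV \<rightarrow> Q" using \<Delta> by simp
    have "absorbing (induced_chain p \<Delta>) D"
      unfolding absorbing_def
    proof (intro ballI allI impI)
      fix x y assume x: "x \<in> D" and y: "0 < induced_chain p \<Delta> $ x $ y"
      have "(\<Sum>y\<in>UNIV. induced_chain p \<Delta> $ x $ y * (- w) $ y) = - w $ x"
        by (simp add: w\<Delta>[of x] payoff_induced_chain sum_negf)
      then have "(- w) $ y = - top"
        using x y top stoch[OF \<Delta>']
        by (intro Prob_mean_at_minimum[of "induced_chain p \<Delta> $ x"]) (auto simp: D_def stochastic_def)
      then show "y \<in> D" by (simp add: D_def)
    qed
    then have "D \<inter> E \<noteq> {}" using meets[OF _ ne(2) \<Delta>'] CE by blast
    then show ?thesis by (auto simp: E_def D_def)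
  qed
  then show ?thesis using m top by (metis antisym)
qed

section \<open>Discounted games and their rescaled limit\<close>

lemma tendsto_val:
  assumes "\<And>s a. (\<lambda>n. c n s a) \<longlonglongrightarrow> c' s a" and "u \<longlonglongrightarrow> u'"
  shows "(\<lambda>n. val (c n) (u n)) \<longlonglongrightarrow> val c' u'"
proof (rule vec_tendstoI)
  fix s
  show "(\<lambda>n. val (c n) (u n) $ s) \<longlonglongrightarrow> val c' u' $ s"
    unfolding val_def vec_lambda_beta
    using assms by (intro stage_game.tendsto_stage_value[OF stage])
qed

lemma val_affine:
  assumes "0 < x" and "\<And>s a s'. c s a + u $ s' = x * (c' s a + u' $ s') + d"
  shows "val c u $ s = x * val c' u' $ s + d"
  unfolding val_def vec_lambda_beta
  by (rule stage_game.stage_value_affine[OF stage[of s]]) (fact assms)+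

text \<open>
  The bound \<open>1 / (1 - \<gamma>)\<close> is the value of receiving reward 1 forever.  The cube with this side is
  mapped into itself because \<open>b = 1 / (1 - \<gamma>)\<close> satisfies \<open>1 + \<gamma> b = b\<close>.
\<close>

lemma discounted_value_exists:
  assumes r: "\<And>s a. 0 \<le> r s a \<and> r s a \<le> 1" and \<gamma>: "0 \<le> \<gamma>" "\<gamma> < 1"
  obtains v where "v = val r (\<gamma> *\<^sub>R v)" and "\<And>s. 0 \<le> v $ s" and "\<And>s. v $ s \<le> 1 / (1 - \<gamma>)"
proof -
  define b where "b = 1 / (1 - \<gamma>)"
  have b: "1 + \<gamma> * b = b" "0 \<le> b" using \<gamma> by (auto simp: b_def field_simps)
  define K :: "(real ^ 's) set" where "K = cbox 0 (\<chi> s. b)"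
  have K: "v \<in> K \<longleftrightarrow> (\<forall>s. 0 \<le> v $ s \<and> v $ s \<le> b)" for v
    by (auto simp: K_def mem_box_cart)
  have "val r (\<gamma> *\<^sub>R v) \<in> K" if "v \<in> K" for v
  proof -
    have lo: "0 \<le> r s a + (\<gamma> *\<^sub>R v) $ s'" and hi: "r s a + (\<gamma> *\<^sub>R v) $ s' \<le> b" for s a s'
    proof -
      have "0 \<le> \<gamma> * v $ s'" "\<gamma> * v $ s' \<le> \<gamma> * b"
        using \<gamma>(1) that by (auto simp: K intro: mult_left_mono)
      then show "0 \<le> r s a + (\<gamma> *\<^sub>R v) $ s'" "r s a + (\<gamma> *\<^sub>R v) $ s' \<le> b"
        using r[of s a] b(1) by auto
    qed
    show ?thesis
      unfolding K val_def vec_lambda_beta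
    proof (intro allI conjI)
      fix s
      show "0 \<le> stage_game.stage_value (P s) Q (r s) (\<gamma> *\<^sub>R v)"
        by (rule stage_game.stage_value_bounds(1)[OF stage[of s]]) (rule lo hi)+
      show "stage_game.stage_value (P s) Q (r s) (\<gamma> *\<^sub>R v) \<le> b"
        by (rule stage_game.stage_value_bounds(2)[OF stage[of s]]) (rule lo hi)+
    qed
  qed
  moreover have "continuous_on K (\<lambda>v. val r (\<gamma> *\<^sub>R v))"
    unfolding continuous_on_sequentially comp_def
  proof (intro allI ballI impI, elim conjE)
    fix x :: "nat \<Rightarrow> real ^ 's" and v assume "x \<longlonglongrightarrow> v"
    then show "(\<lambda>n. val r (\<gamma> *\<^sub>R x n)) \<longlonglongrightarrow> val r (\<gamma> *\<^sub>R v)"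
      by (intro tendsto_val tendsto_const tendsto_scaleR)
  qed
  moreover have "compact K" "convex K" by (auto simp: K_def)
  moreover have "K \<noteq> {}" using K[of 0] b by auto
  ultimately obtain v where "v \<in> K" "val r (\<gamma> *\<^sub>R v) = v"
    using brouwer[of K "\<lambda>v. val r (\<gamma> *\<^sub>R v)"] by blast
  then show ?thesis using that[of v] K[of v] by (simp add: b_def)
qed

text \<open>
  The gain is \<open>\<alpha> = (1 - \<gamma>) v(s0)\<close> for a reference state \<open>s0\<close>: this is the constant left over when
  \<open>v(s0)\<close> is subtracted from both sides of the discounted equation.
\<close>

lemma relative_discounted_value_exists:
  assumes r: "\<And>s a. 0 \<le> r s a \<and> r s a \<le> 1" and \<gamma>: "0 \<le> \<gamma>" "\<gamma> < 1"
  shows "\<exists>h \<alpha>. 0 \<le> \<alpha> \<and> \<alpha> \<le> 1 \<and> (\<exists>s. h $ s = 0) \<and> h = val (\<lambda>s a. r s a - \<alpha>) (\<gamma> *\<^sub>R h)"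
proof -
  obtain v where v: "v = val r (\<gamma> *\<^sub>R v)" "\<And>s. 0 \<le> v $ s" "\<And>s. v $ s \<le> 1 / (1 - \<gamma>)"
    using discounted_value_exists[of r \<gamma>, OF r \<gamma>] by blast
  fix s0 :: 's
  define h :: "real ^ 's" where "h = (\<chi> s. v $ s - v $ s0)"
  define \<alpha> where "\<alpha> = (1 - \<gamma>) * v $ s0"
  have "0 \<le> \<alpha>" unfolding \<alpha>_def using \<gamma> v(2)[of s0] by simp
  moreover have "\<alpha> \<le> 1" using \<gamma> v(3)[of s0] by (simp add: \<alpha>_def field_simps)
  moreover have "h $ s0 = 0" by (simp add: h_def)
  moreover have "h = val (\<lambda>s a. r s a - \<alpha>) (\<gamma> *\<^sub>R h)"
  proof (rule vec_eq_iff[THEN iffD2], rule)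
    fix s
    have "val (\<lambda>s a. r s a - \<alpha>) (\<gamma> *\<^sub>R h) $ s = 1 * val r (\<gamma> *\<^sub>R v) $ s + (- v $ s0)"
      by (rule val_affine) (auto simp: h_def \<alpha>_def algebra_simps)
    then show "h $ s = val (\<lambda>s a. r s a - \<alpha>) (\<gamma> *\<^sub>R h) $ s"
      using arg_cong[OF v(1), of "\<lambda>v. v $ s"] by (simp add: h_def)
  qed
  ultimately show ?thesis by blast
qed

text \<open>
  The limit of the rescaled triples, with rewards surviving exactly when \<open>t'\<close> is positive.
  When \<open>t'\<close> is zero, the limit vector is constant and vanishes somewhere, hence is zero, which the
  normalisation \<open>t' + norm w' = 1\<close> forbids.
\<close>

lemma average_reward_solution_exists:
  assumes r: "\<And>s a. 0 \<le> r s a \<and> r s a \<le> 1"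
    and comp: "\<And>s. compact (P s)"
    and comm: "(weakly_communicating_adversary Q P \<and> compact Q) \<or> communicating_adversary Q P"
  obtains u \<alpha> where "0 \<le> \<alpha>" and "\<alpha> \<le> 1" and "u = val (\<lambda>s a. r s a - \<alpha>) u"
proof -
  define \<gamma> where "\<gamma> n = 1 - inverse (real (Suc n))" for n
  have \<gamma>: "0 \<le> \<gamma> n" "\<gamma> n < 1" for n by (auto simp: \<gamma>_def field_simps)
  have \<gamma>_lim: "\<gamma> \<longlonglongrightarrow> 1"
    unfolding \<gamma>_def using tendsto_diff[OF tendsto_const LIMSEQ_inverse_real_of_nat, of 1] by simp
  have "\<exists>h \<alpha>. 0 \<le> \<alpha> \<and> \<alpha> \<le> 1 \<and> (\<exists>s. h $ s = 0) \<and>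
      h = val (\<lambda>s a. r s a - \<alpha>) (\<gamma> n *\<^sub>R h)" for n
    by (rule relative_discounted_value_exists[of r "\<gamma> n", OF r \<gamma>])
  then obtain h \<alpha> where \<alpha>: "\<And>n. 0 \<le> \<alpha> n \<and> \<alpha> n \<le> 1" and h0: "\<And>n. \<exists>s. h n $ s = 0"
    and h: "\<And>n. h n = val (\<lambda>s a. r s a - \<alpha> n) (\<gamma> n *\<^sub>R h n)"
    by metis
  define t where "t n = inverse (1 + norm (h n))" for n
  define w where "w n = t n *\<^sub>R h n" for n
  have pos: "0 < 1 + norm (h n)" for n by (simp add: add_pos_nonneg)
  have t: "0 < t n" "t n \<le> 1" for n
    using pos[of n] by (auto simp: t_def inverse_le_1_iff)
  have norm_w: "t n + norm (w n) = 1" for n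
    using pos[of n] t[of n] by (simp add: w_def t_def field_simps)
  have w: "w n = val (\<lambda>s a. t n * (r s a - \<alpha> n)) (\<gamma> n *\<^sub>R w n)" for n
  proof (rule vec_eq_iff[THEN iffD2], rule)
    fix s
    have "val (\<lambda>s a. t n * (r s a - \<alpha> n)) (\<gamma> n *\<^sub>R w n) $ s
        = t n * val (\<lambda>s a. r s a - \<alpha> n) (\<gamma> n *\<^sub>R h n) $ s + 0"
      by (rule val_affine) (auto simp: w_def t algebra_simps)
    then show "w n $ s = val (\<lambda>s a. t n * (r s a - \<alpha> n)) (\<gamma> n *\<^sub>R w n) $ s"
      using arg_cong[OF h[of n], of "\<lambda>v. v $ s"] by (simp add: w_def)
  qed
  define K :: "((real ^ 's) \<times> real \<times> real) set" where "K = cball 0 1 \<times> {0..1} \<times> {0..1}"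
  have "compact K" unfolding K_def by (intro compact_Times) auto
  moreover have "\<forall>n. (w n, t n, \<alpha> n) \<in> K"
  proof
    fix n
    have "norm (w n) \<le> 1" "0 \<le> t n" using norm_w[of n] t[of n] by linarith+
    then show "(w n, t n, \<alpha> n) \<in> K" using t[of n] \<alpha>[of n] by (simp add: K_def)
  qed
  ultimately obtain l f where l: "l \<in> K" and f: "strict_mono (f :: nat \<Rightarrow> nat)"
    and lim: "((\<lambda>n. (w n, t n, \<alpha> n)) \<circ> f) \<longlonglongrightarrow> l"
    using seq_compactE[OF compact_imp_seq_compact, of K "\<lambda>n. (w n, t n, \<alpha> n)"] by blast
  obtain w' t' \<alpha>' where l_eq: "l = (w', t', \<alpha>')" by (cases l)
  have bounds: "0 \<le> t'" "0 \<le> \<alpha>'" "\<alpha>' \<le> 1" using l by (auto simp: l_eq K_def)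
  have w_lim: "(\<lambda>n. w (f n)) \<longlonglongrightarrow> w'"
    using tendsto_fst[OF lim] by (simp add: l_eq comp_def)
  have t_lim: "(\<lambda>n. t (f n)) \<longlonglongrightarrow> t'"
    using tendsto_fst[OF tendsto_snd[OF lim]] by (simp add: l_eq comp_def)
  have \<alpha>_lim: "(\<lambda>n. \<alpha> (f n)) \<longlonglongrightarrow> \<alpha>'"
    using tendsto_snd[OF tendsto_snd[OF lim]] by (simp add: l_eq comp_def)
  have \<gamma>f_lim: "(\<lambda>n. \<gamma> (f n)) \<longlonglongrightarrow> 1"
    using LIMSEQ_subseq_LIMSEQ[OF \<gamma>_lim f] by (simp add: comp_def)
  have "(\<lambda>n. w (f n)) = (\<lambda>n. val (\<lambda>s a. t (f n) * (r s a - \<alpha> (f n))) (\<gamma> (f n) *\<^sub>R w (f n)))"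
    using w by blast
  also have "(\<lambda>n. val (\<lambda>s a. t (f n) * (r s a - \<alpha> (f n))) (\<gamma> (f n) *\<^sub>R w (f n)))
      \<longlonglongrightarrow> val (\<lambda>s a. t' * (r s a - \<alpha>')) (1 *\<^sub>R w')"
    by (intro tendsto_val tendsto_intros w_lim t_lim \<alpha>_lim \<gamma>f_lim)
  finally have w': "w' = val (\<lambda>s a. t' * (r s a - \<alpha>')) w'"
    unfolding scaleR_one by (rule LIMSEQ_unique[OF w_lim])
  have "(\<lambda>n. t (f n) + norm (w (f n))) \<longlonglongrightarrow> t' + norm w'"
    by (intro tendsto_intros w_lim t_lim)
  then have norm_w': "t' + norm w' = 1" by (simp add: norm_w LIMSEQ_const_iff)
  have "t' \<noteq> 0"
  proof
    assume "t' = 0"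
    have "w' = val (\<lambda>_ _. 0) w'" using w' unfolding \<open>t' = 0\<close> mult_zero_left .
    then have const: "w' $ s = w' $ s'" for s s'
      by (rule harmonic_imp_constant[OF _ comp comm])
    \<comment> \<open>Each \<open>w n\<close> has a zero, but at a state depending on \<open>n\<close>; the product of the entries is
        continuous and detects a zero wherever it is.\<close>
    have "(\<lambda>n. \<Prod>s\<in>UNIV. w (f n) $ s) \<longlonglongrightarrow> (\<Prod>s\<in>UNIV. w' $ s)"
      by (intro tendsto_intros w_lim)
    moreover have "(\<Prod>s\<in>UNIV. w n $ s) = 0" for n
      using h0[of n] by (auto simp: w_def)
    ultimately have "(\<Prod>s\<in>UNIV. w' $ s) = 0" by (simp add: LIMSEQ_const_iff)
    then obtain s0 where "w' $ s0 = 0" by auto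
    then have "w' $ s = 0" for s using const[of s s0] by simp
    then have "w' = 0" by (simp add: vec_eq_iff)
    then show False using norm_w' \<open>t' = 0\<close> by simp
  qed
  then have t': "0 < t'" using bounds by simp
  define u where "u = (1 / t') *\<^sub>R w'"
  have "u = val (\<lambda>s a. r s a - \<alpha>') u"
  proof (rule vec_eq_iff[THEN iffD2], rule)
    fix s
    have "val (\<lambda>s a. r s a - \<alpha>') u $ s = (1 / t') * val (\<lambda>s a. t' * (r s a - \<alpha>')) w' $ s + 0"
      using t' by (intro val_affine) (auto simp: u_def field_simps)
    then show "u $ s = val (\<lambda>s a. r s a - \<alpha>') u $ s"
      using arg_cong[OF w', of "\<lambda>v. v $ s"] by (simp add: u_def)
  qed
  then show ?thesis using that bounds by blast
qed

end

section \<open>The average-reward equation\<close>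

theorem theorem6:
  fixes r :: "'s::finite \<Rightarrow> 'a::finite \<Rightarrow> real"
    and Q :: "(real ^ 'a) set"
    and P :: "'s \<Rightarrow> (real ^ 's ^ 'a) set"
  assumes "\<And>s a. 0 \<le> r s a \<and> r s a \<le> 1"
    and "Q \<noteq> {}" and "Q \<subseteq> Prob"
    and "\<And>s. P s \<noteq> {}" and "\<And>s. P s \<subseteq> kernels"
    and "(weakly_communicating_adversary Q P \<and> compact Q \<and> (\<forall>s. compact (P s))) \<or>
         (communicating_adversary Q P \<and> (\<forall>s. compact (P s)))"
  shows "\<exists>(u :: 's \<Rightarrow> real) (\<alpha> :: real). 0 \<le> \<alpha> \<and> \<alpha> \<le> 1 \<and>
    (\<forall>s. u s = (INF k\<in>P s. SUP \<phi>\<in>Q.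
       (\<Sum>a\<in>UNIV. \<Sum>s'\<in>UNIV. \<phi> $ a * k $ a $ s' * (r s a - \<alpha> + u s'))))"
proof -
  have stage: "stage_game (P s) Q" for s
    using assms by (simp add: stage_game_def)
  then interpret robust_game P Q
    by (rule robust_game.intro)
  have comp: "compact (P s)" for s
    using assms(6) by blast
  have comm: "(weakly_communicating_adversary Q P \<and> compact Q) \<or> communicating_adversary Q P"
    using assms(6) by blast
  obtain u \<alpha> where "0 \<le> \<alpha>" "\<alpha> \<le> 1" and u: "u = val (\<lambda>s a. r s a - \<alpha>) u"
    using average_reward_solution_exists[of r, OF assms(1) comp comm] by blast
  moreover have "u $ s = (INF k\<in>P s. SUP \<phi>\<in>Q.
       (\<Sum>a\<in>UNIV. \<Sum>s'\<in>UNIV. \<phi> $ a * k $ a $ s' * (r s a - \<alpha> + u $ s')))" for s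
    using arg_cong[OF u, of "\<lambda>v. v $ s"]
    by (simp add: val_def stage_game.stage_value_def[OF stage] stage_game.best_reply_def[OF stage]
        payoff_def)
  ultimately show ?thesis by blast
qed

end
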